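(* Let $P$ be a pushdown automaton, let $P_0$ be the associated extended pushdown automaton, and let $U_1$ be the set of transitions returned by the forward procedure applied to $P_0$ (see context). Then $U_1$ consists of exactly the unreachable transitions in $P_0$, i.e. a transition of $P_0$ belongs to $U_1$ if and only if it is not employed in any run of $P_0$ starting from the initial configuration $(q_0,b_0)$.
   Context: **Pushdown automata.** Input symbols are disregarded. A pushdown automaton (pda) $P$ consists of a finite state set $Q$, a finite stack alphabet $\Gamma$, a finite set of transitions $q\stackrel{\sigma/\tau}{\rightarrow}r$ with $q,r\in Q$ and $\sigma,\tau\in\Gamma^*$ (zero or more symbols may be popped/pushed), an initial state $q_0$ and a set $F\subseteq Q$ of final states; the initial stack is empty. A configuration is a pair of a state and a stack in $\Gamma^*$ (top of the stack at the left). A transition $q\stackrel{\sigma/\tau}{\rightarrow}r$ gives moves $(q,\sigma\rho)\rightarrow(r,\tau\rho)$ for all $\rho\in\Gamma^*$; a run is a sequence of zero or more moves, written $\rightarrow^*$. $\varepsilon$ is the empty string and $\sigma^R$ the reverse of $\sigma$. **The pda $P_0$.** Given $P$, add a fresh stack symbol $b_0$ to $\Gamma$ and let the initial stack be $b_0$ (initial configuration $(q_0,b_0)$). Add fresh states $q_e,q_f$ to $Q$ and transitions $q\stackrel{\varepsilon/\varepsilon}{\rightarrow}q_e$ for every $q\in F$, $q_e\stackrel{a/\varepsilon}{\rightarrow}q_e$ for every $a\in\Gamma\setminus\{b_0\}$, and $q_e\stackrel{b_0/\varepsilon}{\rightarrow}q_f$. Then change $F$ to $\{q_f\}$. From now on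 $Q,\Gamma$ refer to $P_0$. A configuration or transition is reachable if it is employed in a run starting from $(q_0,b_0)$. **The nfa $N$.** $N$ is a nondeterministic finite automaton under construction, with labels in $\Gamma\cup\{\varepsilon\}$ and initial state $m_0$. Its final states are elements of $Q$; its other states ($m_0$ and fresh intermediate states) are non-final. We write $x\stackrel{a_1\ldots a_k}{\leadsto}y$ for a path in $N$ from $x$ to $y$ whose consecutive labels are exactly $a_1,\dots,a_k\in\Gamma$ (no $\varepsilon$-transitions; $k\ge 0$), and $x\stackrel{a_1\ldots a_k}{\Rightarrow}y$ for such a path possibly intertwined with $\varepsilon$-transitions. **Forward procedure.** Initially $N$ consists of the single transition $m_0\stackrel{b_0}{\rightarrow}q_0$ ($m_0$ fresh, non-final; $q_0$ final), and $U_1$ contains all transitions of $P_0$. One run of the procedure does the following for each transition $\theta=q\stackrel{\sigma/\tau}{\rightarrow}r$ of $P_0$: 1. If $q$ is not a state of $N$, stop this iteration step. 2. Determine $S_{q,\sigma}$: $S_{q,\sigma}=\{q\}$ if $\sigma=\varepsilon$; if $\sigma=\sigma'a$ with $a\in\Gamma$, it is the set of states $n$ for which there is a path $n\stackrel{a}{\rightarrow}y\stackrel{\sigma'^R}{\Rightarrow}q$ in $N$. 3. If $S_{q,\sigma}=\emptyset$, stop this iteration step. 4. If $\theta\in U_1$, delete $\theta$ from $U_1$ and establish a path $\stackrel{\tau^R}{\leadsto}r$ in $N$; the state $r$ is final in $N$. 5. Let $y$ be the first state of the path $\stackrel{\tau^R}{\leadsto}r$. For each $x\in S_{q,\sigma}$,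 add the transition $x\stackrel{\varepsilon}{\rightarrow}y$ to $N$ if not yet present. Establishing a path $\stackrel{a_1\ldots a_k}{\leadsto}z$ and returning its first state: if $k=0$, return $z$; otherwise, if there is a transition $n\stackrel{a_k}{\rightarrow}z$ in $N$ with $n$ non-final (there is at most one), establish a path $\stackrel{a_1\ldots a_{k-1}}{\leadsto}n$ and return its first state; otherwise add fresh non-final states $n_1,\dots,n_k$ and transitions $n_1\stackrel{a_1}{\rightarrow}n_2\cdots n_k\stackrel{a_k}{\rightarrow}z$ and return $n_1$. If $N$ changed during a run over all transitions of $P_0$, the procedure is run again over all transitions; otherwise it stops and returns $N$ and $U_1$. *)

theory Defs
  imports Main
begin

text \<open>The quadruple \<open>(q, \<sigma>, \<tau>, r)\<close> pops \<open>\<sigma>\<close> and pushes \<open>\<tau>\<close>.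
  Stacks are lists whose head is the top.\<close>

type_synonym ('q, 'a) transition = "'q \<times> 'a list \<times> 'a list \<times> 'q"

type_synonym ('q, 'a) config = "'q \<times> 'a list"

record ('q, 'a) pda =
  states :: "'q set"
  alphabet :: "'a set"
  transitions :: "('q, 'a) transition set"
  initial :: 'q
  finals :: "'q set"

definition is_pda :: "('q, 'a) pda \<Rightarrow> bool" where
  "is_pda P \<longleftrightarrow>
     finite (states P) \<and> finite (alphabet P) \<and> finite (transitions P) \<and>
     transitions P \<subseteq> states P \<times> lists (alphabet P) \<times> lists (alphabet P) \<times> states P \<and>
     initial P \<in> states P \<and> finals P \<subseteq> states P"

inductive move :: "('q, 'a) pda \<Rightarrow> ('q, 'a) config \<Rightarrow> ('q, 'a) transition \<Rightarrow> ('q, 'a) config \<Rightarrow> bool"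
  for P where
  "\<lbrakk>(q, \<sigma>, \<tau>, r) \<in> transitions P; \<rho> \<in> lists (alphabet P)\<rbrakk>
    \<Longrightarrow> move P (q, \<sigma> @ \<rho>) (q, \<sigma>, \<tau>, r) (r, \<tau> @ \<rho>)"

inductive run :: "('q, 'a) pda \<Rightarrow> ('q, 'a) config \<Rightarrow> ('q, 'a) transition list \<Rightarrow> ('q, 'a) config \<Rightarrow> bool"
  for P where
  run_Nil: "run P c [] c"
| run_Cons: "\<lbrakk>move P c \<theta> c'; run P c' \<theta>s c''\<rbrakk> \<Longrightarrow> run P c (\<theta> # \<theta>s) c''"

definition reachable_transition ::
    "('q, 'a) pda \<Rightarrow> ('q, 'a) config \<Rightarrow> ('q, 'a) transition \<Rightarrow> bool" where
  "reachable_transition P c \<theta> \<longleftrightarrow> (\<exists>\<theta>s c'. run P c \<theta>s c' \<and> \<theta> \<in> set \<theta>s)"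

datatype 'q xstate = Old 'q | Qe | Qf

datatype 'a xsym = Sym 'a | B0

definition extended_pda :: "('q, 'a) pda \<Rightarrow> ('q xstate, 'a xsym) pda" where
  "extended_pda P =
     \<lparr>states = Old ` states P \<union> {Qe, Qf},
      alphabet = Sym ` alphabet P \<union> {B0},
      transitions =
        {(Old q, map Sym \<sigma>, map Sym \<tau>, Old r) | q \<sigma> \<tau> r. (q, \<sigma>, \<tau>, r) \<in> transitions P}
        \<union> {(Old q, [], [], Qe) | q. q \<in> finals P}
        \<union> {(Qe, [Sym a], [], Qe) | a. a \<in> alphabet P}
        \<union> {(Qe, [B0], [], Qf)},
      initial = Old (initial P),
      finals = {Qf}\<rparr>"

definition initial_config :: "('q, 'a xsym) pda \<Rightarrow> ('q, 'a xsym) config" where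
  "initial_config P0 = (initial P0, [B0])"

text \<open>The final states are those of the form \<open>Final q\<close>; the initial state is \<open>M0\<close>.\<close>

datatype 'q nstate = M0 | Fresh nat | Final 'q

definition nonfinal :: "'q nstate \<Rightarrow> bool" where
  "nonfinal n \<longleftrightarrow> (\<forall>q. n \<noteq> Final q)"

text \<open>The label \<open>None\<close> stands for \<open>\<epsilon>\<close>.\<close>

record ('q, 'a) nfa =
  nstates :: "'q nstate set"
  ntrans :: "('q nstate \<times> 'a option \<times> 'q nstate) set"

inductive strict_path :: "('q, 'a) nfa \<Rightarrow> 'q nstate \<Rightarrow> 'a list \<Rightarrow> 'q nstate \<Rightarrow> bool"
  for N where
  strict_path_Nil: "strict_path N x [] x"
| strict_path_Cons: "\<lbrakk>(x, Some a, y) \<in> ntrans N; strict_path N y w z\<rbrakk>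
    \<Longrightarrow> strict_path N x (a # w) z"

inductive eps_path :: "('q, 'a) nfa \<Rightarrow> 'q nstate \<Rightarrow> 'a list \<Rightarrow> 'q nstate \<Rightarrow> bool"
  for N where
  eps_path_Nil: "eps_path N x [] x"
| eps_path_Eps: "\<lbrakk>(x, None, y) \<in> ntrans N; eps_path N y w z\<rbrakk> \<Longrightarrow> eps_path N x w z"
| eps_path_Cons: "\<lbrakk>(x, Some a, y) \<in> ntrans N; eps_path N y w z\<rbrakk>
    \<Longrightarrow> eps_path N x (a # w) z"

definition pop_sources :: "('q, 'a) nfa \<Rightarrow> 'q \<Rightarrow> 'a list \<Rightarrow> 'q nstate set" where
  "pop_sources N q \<sigma> =
     (if \<sigma> = [] then {Final q}
      else {n. \<exists>y. (n, Some (last \<sigma>), y) \<in> ntrans N \<and>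
                   eps_path N y (rev (butlast \<sigma>)) (Final q)})"

text \<open>\<open>establish N w z N' y\<close>: establishing a path labelled \<open>w\<close> to \<open>z\<close> in \<open>N\<close> may result
  in \<open>N'\<close> and return \<open>y\<close>. It is a relation because the choice of fresh states is left open.\<close>

inductive establish ::
    "('q, 'a) nfa \<Rightarrow> 'a list \<Rightarrow> 'q nstate \<Rightarrow> ('q, 'a) nfa \<Rightarrow> 'q nstate \<Rightarrow> bool" where
  establish_Nil: "establish N [] z N z"
| establish_reuse:
    "\<lbrakk>(n, Some a, z) \<in> ntrans N; nonfinal n; establish N w n N' y\<rbrakk>
      \<Longrightarrow> establish N (w @ [a]) z N' y"
| establish_fresh:
    "\<lbrakk>w \<noteq> []; \<not> (\<exists>n. (n, Some (last w), z) \<in> ntrans N \<and> nonfinal n);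
      length ns = length w; distinct ns; \<forall>n \<in> set ns. nonfinal n \<and> n \<noteq> M0 \<and> n \<notin> nstates N;
      N' = N\<lparr>nstates := nstates N \<union> set ns,
             ntrans := ntrans N \<union> {(ns ! i, Some (w ! i), (ns @ [z]) ! Suc i) | i. i < length w}\<rparr>\<rbrakk>
      \<Longrightarrow> establish N w z N' (hd ns)"

definition add_state :: "'q nstate \<Rightarrow> ('q, 'a) nfa \<Rightarrow> ('q, 'a) nfa" where
  "add_state n N = N\<lparr>nstates := insert n (nstates N)\<rparr>"

definition add_eps :: "'q nstate set \<Rightarrow> 'q nstate \<Rightarrow> ('q, 'a) nfa \<Rightarrow> ('q, 'a) nfa" where
  "add_eps S y N = N\<lparr>ntrans := ntrans N \<union> {(x, None, y) | x. x \<in> S}\<rparr>"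

type_synonym ('q, 'a) pstate = "('q, 'a) nfa \<times> ('q, 'a) transition set"

inductive process ::
    "('q, 'a) transition \<Rightarrow> ('q, 'a) pstate \<Rightarrow> ('q, 'a) pstate \<Rightarrow> bool" where
  process_stop:
    "Final q \<notin> nstates N \<or> pop_sources N q \<sigma> = {}
      \<Longrightarrow> process (q, \<sigma>, \<tau>, r) (N, U) (N, U)"
| process_new:
    "\<lbrakk>Final q \<in> nstates N; pop_sources N q \<sigma> \<noteq> {}; (q, \<sigma>, \<tau>, r) \<in> U;
      establish (add_state (Final r) N) (rev \<tau>) (Final r) N' y\<rbrakk>
      \<Longrightarrow> process (q, \<sigma>, \<tau>, r) (N, U)
            (add_eps (pop_sources N q \<sigma>) y N', U - {(q, \<sigma>, \<tau>, r)})"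
| process_old:
    "\<lbrakk>Final q \<in> nstates N; pop_sources N q \<sigma> \<noteq> {}; (q, \<sigma>, \<tau>, r) \<notin> U;
      strict_path N y (rev \<tau>) (Final r)\<rbrakk>
      \<Longrightarrow> process (q, \<sigma>, \<tau>, r) (N, U) (add_eps (pop_sources N q \<sigma>) y N, U)"

inductive process_list ::
    "('q, 'a) transition list \<Rightarrow> ('q, 'a) pstate \<Rightarrow> ('q, 'a) pstate \<Rightarrow> bool" where
  process_list_Nil: "process_list [] s s"
| process_list_Cons: "\<lbrakk>process \<theta> s s'; process_list \<theta>s s' s''\<rbrakk>
    \<Longrightarrow> process_list (\<theta> # \<theta>s) s s''"

text \<open>One run over all transitions, in an arbitrary order, which may differ from run to run.\<close>

definition pass :: "('q, 'a) pda \<Rightarrow> ('q, 'a) pstate \<Rightarrow> ('q, 'a) pstate \<Rightarrow> bool" where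
  "pass P0 s s' \<longleftrightarrow>
     (\<exists>\<theta>s. distinct \<theta>s \<and> set \<theta>s = transitions P0 \<and> process_list \<theta>s s s')"

text \<open>States and transitions of the nfa are only ever added, so it changed during a run
  iff it differs at the end of the run.\<close>

inductive iterate :: "('q, 'a) pda \<Rightarrow> ('q, 'a) pstate \<Rightarrow> ('q, 'a) pstate \<Rightarrow> bool"
  for P0 where
  iterate_stop: "pass P0 (N, U) (N, U') \<Longrightarrow> iterate P0 (N, U) (N, U')"
| iterate_again: "\<lbrakk>pass P0 (N, U) (N', U'); N' \<noteq> N; iterate P0 (N', U') s\<rbrakk>
    \<Longrightarrow> iterate P0 (N, U) s"

definition initial_nfa :: "('q, 'a xsym) pda \<Rightarrow> ('q, 'a xsym) nfa" where
  "initial_nfa P0 =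
     \<lparr>nstates = {M0, Final (initial P0)}, ntrans = {(M0, Some B0, Final (initial P0))}\<rparr>"

definition forward_returns ::
    "('q, 'a xsym) pda \<Rightarrow> ('q, 'a xsym) nfa \<Rightarrow> ('q, 'a xsym) transition set \<Rightarrow> bool" where
  "forward_returns P0 N U1 \<longleftrightarrow> iterate P0 (initial_nfa P0, transitions P0) (N, U1)"

end

theory Submission
  imports Defs
begin

text \<open>Read as a constraint on a word \<open>w\<close> leading from \<open>M0\<close> to \<open>x\<close>, the property
  \<open>admissible N x w\<close> says that completing \<open>w\<close> by any symbol path from \<open>x\<close> to a final
  state yields (reversed) the stack of a reachable configuration. Symbol transitions preserve it
  trivially. An \<open>\<epsilon>\<close>-transition added for \<open>(q, \<sigma>, \<tau>, r)\<close> preserves it because symbol paths to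
  final states are unique, so that the only completion at its target is \<open>rev \<tau>\<close> with end \<open>r\<close>.
  As all states of the nfa are accessible, every transition deleted from \<open>U\<^sub>1\<close> is reachable.
  Conversely, in a last run the nfa does not change, so it is saturated, and then induction
  on runs shows that it accepts every reachable configuration. The procedure terminates since
  each further run deletes a transition from \<open>U\<^sub>1\<close> or adds an \<open>\<epsilon>\<close>-transition between
  existing states.\<close>

section \<open>Paths\<close>

lemma strict_path_imp_eps_path: "strict_path N x w y \<Longrightarrow> eps_path N x w y"
  by (induction rule: strict_path.induct) (auto intro: eps_path.intros)

lemma strict_path_append:
  "strict_path N x u y \<Longrightarrow> strict_path N y v z \<Longrightarrow> strict_path N x (u @ v) z"
  by (induction rule: strict_path.induct) (auto intro: strict_path.intros)

lemma eps_path_append: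
  "eps_path N x u y \<Longrightarrow> eps_path N y v z \<Longrightarrow> eps_path N x (u @ v) z"
  by (induction rule: eps_path.induct) (auto intro: eps_path.intros)

lemma strict_path_mono:
  "strict_path N x w y \<Longrightarrow> ntrans N \<subseteq> ntrans N' \<Longrightarrow> strict_path N' x w y"
  by (induction rule: strict_path.induct) (auto intro: strict_path.intros)

lemma eps_path_mono:
  "eps_path N x w y \<Longrightarrow> ntrans N \<subseteq> ntrans N' \<Longrightarrow> eps_path N' x w y"
  by (induction rule: eps_path.induct) (auto intro: eps_path.intros)

lemma pop_sources_mono:
  "ntrans N \<subseteq> ntrans N' \<Longrightarrow> pop_sources N q \<sigma> \<subseteq> pop_sources N' q \<sigma>"
  by (auto simp: pop_sources_def dest: eps_path_mono)

text \<open>With \<open>a\<close> the deepest popped symbol, \<open>n\<close> is a state that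
  \<open>pop_sources\<close> collects, and \<open>u\<close> is the reversed rest of the
  stack.\<close>

lemma eps_path_split:
  assumes "eps_path N x w z" "w = u @ a # v"
  shows "\<exists>n y. eps_path N x u n \<and> (n, Some a, y) \<in> ntrans N \<and> eps_path N y v z"
  using assms
proof (induction arbitrary: u rule: eps_path.induct)
  case (eps_path_Nil x)
  then show ?case by simp
next
  case (eps_path_Eps x y w z)
  then show ?case by (blast intro: eps_path.eps_path_Eps)
next
  case (eps_path_Cons x b y w z)
  show ?case
  proof (cases u)
    case Nil
    then show ?thesis using eps_path_Cons by (auto intro: eps_path.intros)
  next
    case (Cons c u')
    then show ?thesis using eps_path_Cons by (auto intro: eps_path.intros)
  qed
qed

text \<open>\<open>A\<close> is a region that symbol transitions of \<open>N'\<close> cannot leave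
  and on which they already belong to \<open>N\<close>: the old states once new paths are grafted,
  and \<open>UNIV\<close> once epsilon-transitions are added.\<close>

lemma strict_path_cong_ntrans:
  assumes "strict_path N' x u z" "x \<in> A"
    and "\<And>x a y. (x, Some a, y) \<in> ntrans N' \<Longrightarrow> x \<in> A \<Longrightarrow> (x, Some a, y) \<in> ntrans N \<and> y \<in> A"
  shows "strict_path N x u z"
  using assms(1,2)
  by (induction rule: strict_path.induct) (auto intro: strict_path.intros dest: assms(3))

section \<open>Well-formed automata and path establishment\<close>

text \<open>The last clause is stronger than determinism, as the symbol is not given in advance;
  since final states have no way out by a symbol, symbol paths to final states are then unique.
  Epsilon-transitions may branch freely.\<close>

definition wf_nfa :: "('q, 'a) nfa \<Rightarrow> bool" where
  "wf_nfa N \<longleftrightarrow> finite (nstates N) \<and> M0 \<in> nstates N \<and>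
     (\<forall>x l y. (x, l, y) \<in> ntrans N \<longrightarrow> x \<in> nstates N \<and> y \<in> nstates N) \<and>
     (\<forall>q a y. (Final q, Some a, y) \<notin> ntrans N) \<and>
     (\<forall>x a y b z. (x, Some a, y) \<in> ntrans N \<longrightarrow> (x, Some b, z) \<in> ntrans N \<longrightarrow> a = b \<and> y = z)"

lemma wf_nfaD:
  assumes "wf_nfa N"
  shows "finite (nstates N)" "M0 \<in> nstates N"
    "(x, l, y) \<in> ntrans N \<Longrightarrow> x \<in> nstates N"
    "(x, l, y) \<in> ntrans N \<Longrightarrow> y \<in> nstates N"
    "(Final q, Some a, y) \<notin> ntrans N"
    "(x, Some a, y) \<in> ntrans N \<Longrightarrow> (x, Some b, z) \<in> ntrans N \<Longrightarrow> a = b \<and> y = z"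
  using assms unfolding wf_nfa_def by blast+

lemma strict_path_start_in_nstates:
  "wf_nfa N \<Longrightarrow> strict_path N x u z \<Longrightarrow> z \<in> nstates N \<Longrightarrow> x \<in> nstates N"
  by (metis strict_path.cases wf_nfaD(3))

lemma strict_path_end_in_nstates:
  "strict_path N x u z \<Longrightarrow> wf_nfa N \<Longrightarrow> x \<in> nstates N \<Longrightarrow> z \<in> nstates N"
  by (induction rule: strict_path.induct) (auto dest: wf_nfaD)

lemma eps_path_end_in_nstates:
  "eps_path N x u z \<Longrightarrow> wf_nfa N \<Longrightarrow> x \<in> nstates N \<Longrightarrow> z \<in> nstates N"
  by (induction rule: eps_path.induct) (auto dest: wf_nfaD)

text \<open>Both paths follow the only symbol transition out of each state, and neither can stop
  before the other since no symbol transition leaves a final state.\<close>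

lemma strict_path_to_Final_unique:
  assumes "wf_nfa N" "strict_path N x u z" "strict_path N x v z'" "z = Final q" "z' = Final r"
  shows "u = v \<and> q = r"
  using assms(2-)
proof (induction arbitrary: v rule: strict_path.induct)
  case (strict_path_Nil x)
  from strict_path_Nil(1) show ?case
    by cases (use strict_path_Nil wf_nfaD(5)[OF assms(1)] in auto)
next
  case (strict_path_Cons x a y w z)
  from strict_path_Cons.prems(1) show ?case
  proof cases
    case strict_path_Nil
    then show ?thesis using strict_path_Cons wf_nfaD(5)[OF assms(1)] by auto
  next
    case (strict_path_Cons b y' w')
    then show ?thesis
      using strict_path_Cons.IH strict_path_Cons.hyps strict_path_Cons.prems
        wf_nfaD(6)[OF assms(1)] by blast
  qed
qed

section \<open>Extensions of an automaton and fresh paths\<close>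

definition extends :: "('q, 'a) nfa \<Rightarrow> ('q, 'a) nfa \<Rightarrow> bool" where
  "extends N N' \<longleftrightarrow> nstates N \<subseteq> nstates N' \<and> ntrans N \<subseteq> ntrans N'"

lemma extends_refl: "extends N N"
  by (simp add: extends_def)

lemma extends_trans: "extends N N' \<Longrightarrow> extends N' N'' \<Longrightarrow> extends N N''"
  by (auto simp: extends_def)

lemma extends_antisym: "extends N N' \<Longrightarrow> extends N' N \<Longrightarrow> N = N'"
  by (auto simp: extends_def)

text \<open>If \<open>N\<close> is well-formed, a symbol path that starts in a state of
  \<open>N\<close> never meets an added transition, so old states keep exactly their symbol
  paths.\<close>

definition grafts :: "('q, 'a) nfa \<Rightarrow> ('q, 'a) nfa \<Rightarrow> bool" where
  "grafts N N' \<longleftrightarrow> extends N N' \<and>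
     (\<forall>x l y. (x, l, y) \<in> ntrans N' - ntrans N \<longrightarrow> l \<noteq> None \<and> x \<notin> nstates N)"

lemma wf_nfa_graft_path:
  fixes N :: "('q, 'a) nfa"
  assumes N: "wf_nfa N" and z: "z \<in> nstates N" and w: "w \<noteq> []" and len: "length ns = length w"
    and dist: "distinct ns" and new: "\<forall>n \<in> set ns. nonfinal n \<and> n \<noteq> M0 \<and> n \<notin> nstates N"
    and N': "N' = N\<lparr>nstates := nstates N \<union> set ns,
             ntrans := ntrans N \<union> {(ns ! i, Some (w ! i), (ns @ [z]) ! Suc i) | i. i < length w}\<rparr>"
  shows "wf_nfa N' \<and> grafts N N' \<and> strict_path N' (hd ns) w z \<and>
     (\<forall>x \<in> nstates N' - nstates N. \<exists>u. eps_path N' (hd ns) u x)"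
proof (intro conjI)
  define E where "E = {(ns ! i, Some (w ! i), (ns @ [z]) ! Suc i) | i. i < length w}"
  have tr: "ntrans N' = ntrans N \<union> E" and st: "nstates N' = nstates N \<union> set ns"
    by (simp_all add: N' E_def)
  have edge: "(ns ! i, Some (w ! i), (ns @ [z]) ! Suc i) \<in> ntrans N'" if "i < length w" for i
    using that by (auto simp: tr E_def)
  have E: "\<exists>i < length w. x = ns ! i \<and> l = Some (w ! i) \<and> y = (ns @ [z]) ! Suc i"
    if "(x, l, y) \<in> E" for x l y
    using that by (auto simp: E_def)
  have Ex: "x \<in> set ns" if "(x, l, y) \<in> E" for x l y
    using E[OF that] len by auto
  have Ey: "y \<in> nstates N'" if "(x, l, y) \<in> E" for x l y
    using E[OF that] len z by (auto simp: st nth_append)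
  have Edet: "l = l' \<and> y = y'" if "(x, l, y) \<in> E" "(x, l', y') \<in> E" for x l y l' y'
    using E[OF that(1)] E[OF that(2)] len dist by (auto simp: nth_eq_iff_index_eq)
  have old: "x \<notin> set ns" if "(x, l, y) \<in> ntrans N" for x l y
    using wf_nfaD(3)[OF N that] new by auto
  show "wf_nfa N'"
    unfolding wf_nfa_def
  proof (intro conjI allI impI)
    show "finite (nstates N')" "M0 \<in> nstates N'"
      using wf_nfaD(1,2)[OF N] by (auto simp: st)
    fix x l y assume "(x, l, y) \<in> ntrans N'"
    then show "x \<in> nstates N'" "y \<in> nstates N'"
      using wf_nfaD(3,4)[OF N] Ex Ey unfolding tr st by blast+
  next
    fix q a y show "(Final q, Some a, y) \<notin> ntrans N'"
      using wf_nfaD(5)[OF N] Ex[of "Final q" "Some a" y] new by (auto simp: tr nonfinal_def)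
  next
    fix x a y b y' assume "(x, Some a, y) \<in> ntrans N'" "(x, Some b, y') \<in> ntrans N'"
    \<comment> \<open>Old and fresh sources are disjoint, so two transitions out of one state are
      both old or both new.\<close>
    then have "(x, Some a, y) \<in> ntrans N \<and> (x, Some b, y') \<in> ntrans N \<or>
        (x, Some a, y) \<in> E \<and> (x, Some b, y') \<in> E"
      using old[of x] Ex[of x] unfolding tr Un_iff by metis
    then show "a = b" "y = y'"
      using wf_nfaD(6)[OF N] Edet by blast+
  qed
  show "grafts N N'"
    unfolding grafts_def extends_def using E Ex new by (fastforce simp: tr st)
  have ne: "ns \<noteq> []" using w len by auto
  \<comment> \<open>The induction runs downwards from the end \<open>z\<close>, the entry of
    \<open>ns @ [z]\<close> at index \<open>length w\<close>; index 0 then gives the whole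
    path.\<close>
  have "strict_path N' ((ns @ [z]) ! i) (drop i w) z" if "i \<le> length w" for i
    using that
  proof (induction i rule: inc_induct)
    case base
    then show ?case using len by (simp add: nth_append strict_path_Nil)
  next
    case (step i)
    then show ?case
      using edge[of i] len
      by (auto simp: nth_append Cons_nth_drop_Suc[symmetric] intro: strict_path_Cons)
  qed
  from this[of 0] show "strict_path N' (hd ns) w z"
    using ne by (simp add: hd_conv_nth nth_append)
  have "\<exists>u. eps_path N' (hd ns) u (ns ! i)" if "i < length w" for i
    using that
  proof (induction i)
    case 0
    then show ?case using ne by (auto simp: hd_conv_nth intro: eps_path_Nil)
  next
    case (Suc i)
    then obtain u where "eps_path N' (hd ns) u (ns ! i)" by auto
    moreover have "eps_path N' (ns ! i) [w ! i] (ns ! Suc i)"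
      using edge[of i] Suc.prems len by (auto simp: nth_append intro: eps_path.intros)
    ultimately show ?case by (blast intro: eps_path_append)
  qed
  then show "\<forall>x \<in> nstates N' - nstates N. \<exists>u. eps_path N' (hd ns) u x"
    using len by (auto simp: st in_set_conv_nth)
qed

text \<open>In the reuse case the recursive path ends in \<open>n\<close>, and the transition to
  \<open>z\<close> completes it. The last conjunct places the added states behind the returned one,
  which later makes them accessible.\<close>

lemma establish_correct:
  assumes "establish N w z N' y" "wf_nfa N" "z \<in> nstates N"
  shows "wf_nfa N' \<and> grafts N N' \<and> strict_path N' y w z \<and>
     (\<forall>x \<in> nstates N' - nstates N. \<exists>u. eps_path N' y u x)"
  using assms
proof (induction rule: establish.induct)
  case (establish_Nil N z)
  then show ?case by (auto simp: grafts_def extends_def intro: strict_path_Nil)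
next
  case (establish_reuse n a z N w N' y)
  then have IH: "wf_nfa N' \<and> grafts N N' \<and> strict_path N' y w n \<and>
     (\<forall>x \<in> nstates N' - nstates N. \<exists>u. eps_path N' y u x)"
    by (auto dest: wf_nfaD(3))
  moreover have "strict_path N' n [a] z"
    using IH establish_reuse.hyps(1)
    by (auto simp: grafts_def extends_def intro: strict_path.intros)
  ultimately show ?case by (blast intro: strict_path_append)
next
  case (establish_fresh w N z ns N')
  then show ?case by (intro wf_nfa_graft_path) auto
qed

lemma establish_exists:
  assumes "finite (nstates N)"
  shows "\<exists>N' y. establish N w z N' y"
proof (induction w arbitrary: z rule: rev_induct)
  case Nil
  then show ?case by (blast intro: establish_Nil)
next
  case (snoc a w)
  show ?case
  proof (cases "\<exists>n. (n, Some a, z) \<in> ntrans N \<and> nonfinal n")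
    case True
    then show ?thesis using snoc by (blast intro: establish_reuse)
  next
    case False
    have "finite {i. Fresh i \<in> nstates N}"
      using finite_vimageI[OF assms, of Fresh] by (simp add: inj_def vimage_def)
    then obtain k where k: "\<And>i. Fresh i \<in> nstates N \<Longrightarrow> i < k"
      using finite_nat_set_iff_bounded by auto
    define ns where "ns = (map Fresh [k..<k + length (w @ [a])] :: 'a nstate list)"
    have "distinct ns" by (auto simp: ns_def distinct_map inj_on_def)
    moreover have "\<forall>n \<in> set ns. nonfinal n \<and> n \<noteq> M0 \<and> n \<notin> nstates N"
      using k by (fastforce simp: ns_def nonfinal_def)
    moreover have "length ns = length (w @ [a])" by (simp add: ns_def)
    ultimately have "establish N (w @ [a]) z
        (N\<lparr>nstates := nstates N \<union> set ns, ntrans := ntrans N \<union>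
          {(ns ! i, Some ((w @ [a]) ! i), (ns @ [z]) ! Suc i) | i. i < length (w @ [a])}\<rparr>) (hd ns)"
      using False by (intro establish_fresh) auto
    then show ?thesis by blast
  qed
qed

section \<open>Soundness invariant\<close>

lemma run_append: "run P c \<theta>s c' \<Longrightarrow> run P c' \<theta>s' c'' \<Longrightarrow> run P c (\<theta>s @ \<theta>s') c''"
  by (induction rule: run.induct) (auto intro: run.intros)

text \<open>The argument runs for any automaton with these properties. The alphabet facts keep
  reachable stacks over the alphabet, as \<open>move\<close> demands of the untouched part of the
  stack.\<close>

locale forward =
  fixes P0 :: "('q, 'a xsym) pda"
  assumes finite_transitions: "finite (transitions P0)"
    and push_alphabet: "(q, \<sigma>, \<tau>, r) \<in> transitions P0 \<Longrightarrow> \<tau> \<in> lists (alphabet P0)"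
    and B0_alphabet: "B0 \<in> alphabet P0"
begin

definition reach :: "('q, 'a xsym) config \<Rightarrow> bool" where
  "reach c \<longleftrightarrow> (\<exists>\<theta>s. run P0 (initial_config P0) \<theta>s c)"

text \<open>Completions avoid epsilon-transitions on purpose: adding one then changes no
  admissibility, and its effect is confined to the closure condition in
  \<open>sound_nfa\<close>.\<close>

definition admissible :: "('q, 'a xsym) nfa \<Rightarrow> 'q nstate \<Rightarrow> 'a xsym list \<Rightarrow> bool" where
  "admissible N x w \<longleftrightarrow> (\<forall>u r. strict_path N x u (Final r) \<longrightarrow> reach (r, rev (w @ u)))"

definition sound_nfa :: "('q, 'a xsym) nfa \<Rightarrow> bool" where
  "sound_nfa N \<longleftrightarrow> wf_nfa N \<and> admissible N M0 [] \<and>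
     (\<forall>x y w. (x, None, y) \<in> ntrans N \<longrightarrow> admissible N x w \<longrightarrow> admissible N y w)"

text \<open>Together with soundness, this turns a nonempty set of pop sources into a reachable
  configuration in which the transition can be used.\<close>

definition accessible :: "('q, 'a xsym) nfa \<Rightarrow> bool" where
  "accessible N \<longleftrightarrow> (\<forall>x \<in> nstates N. \<exists>w. eps_path N M0 w x)"

text \<open>For a transition already deleted, the last clause also preserves its established path,
  which \<open>process_old\<close> must find again.\<close>

definition invariant :: "('q, 'a xsym) pstate \<Rightarrow> bool" where
  "invariant = (\<lambda>(N, U). sound_nfa N \<and> accessible N \<and> U \<subseteq> transitions P0 \<and>
     (\<forall>(q, \<sigma>, \<tau>, r) \<in> transitions P0 - U.
        reachable_transition P0 (initial_config P0) (q, \<sigma>, \<tau>, r) \<and>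
        Final r \<in> nstates N \<and> (\<exists>y. strict_path N y (rev \<tau>) (Final r))))"

lemma invariant_processed:
  assumes "invariant (N, U)" "(q, \<sigma>, \<tau>, r) \<in> transitions P0" "(q, \<sigma>, \<tau>, r) \<notin> U"
  shows "reachable_transition P0 (initial_config P0) (q, \<sigma>, \<tau>, r)"
    "Final r \<in> nstates N" "\<exists>y. strict_path N y (rev \<tau>) (Final r)"
  using assms by (auto simp: invariant_def dest!: bspec[of _ _ "(q, \<sigma>, \<tau>, r)"])

section \<open>Reachable configurations\<close>

lemma run_stack_alphabet:
  "run P0 c \<theta>s c' \<Longrightarrow> snd c \<in> lists (alphabet P0) \<Longrightarrow> snd c' \<in> lists (alphabet P0)"
  by (induction rule: run.induct) (fastforce elim!: move.cases dest: push_alphabet)+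

lemma reach_stack_alphabet: "reach (q, s) \<Longrightarrow> s \<in> lists (alphabet P0)"
  using run_stack_alphabet[of "initial_config P0"] B0_alphabet
  by (fastforce simp: reach_def initial_config_def)

lemma reach_initial: "reach (initial P0, [B0])"
  by (auto simp: reach_def initial_config_def intro: run_Nil)

lemma reach_move:
  assumes "reach (q, \<sigma> @ \<rho>)" "(q, \<sigma>, \<tau>, r) \<in> transitions P0"
  shows "reach (r, \<tau> @ \<rho>)"
    and "reachable_transition P0 (initial_config P0) (q, \<sigma>, \<tau>, r)"
proof -
  obtain \<theta>s where "run P0 (initial_config P0) \<theta>s (q, \<sigma> @ \<rho>)"
    using assms(1) by (auto simp: reach_def)
  moreover have "move P0 (q, \<sigma> @ \<rho>) (q, \<sigma>, \<tau>, r) (r, \<tau> @ \<rho>)"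
    using assms reach_stack_alphabet[OF assms(1)] by (auto intro: move.intros)
  then have "run P0 (q, \<sigma> @ \<rho>) [(q, \<sigma>, \<tau>, r)] (r, \<tau> @ \<rho>)"
    by (auto intro: run.intros)
  ultimately have "run P0 (initial_config P0) (\<theta>s @ [(q, \<sigma>, \<tau>, r)]) (r, \<tau> @ \<rho>)"
    by (rule run_append)
  then show "reach (r, \<tau> @ \<rho>)" "reachable_transition P0 (initial_config P0) (q, \<sigma>, \<tau>, r)"
    by (auto simp: reach_def reachable_transition_def simp del: set_append
        intro!: exI[of _ "\<theta>s @ [(q, \<sigma>, \<tau>, r)]"]) auto
qed

section \<open>Admissibility along paths\<close>

lemma sound_nfaD:
  assumes "sound_nfa N"
  shows "wf_nfa N" "admissible N M0 []"
    "(x, None, y) \<in> ntrans N \<Longrightarrow> admissible N x w \<Longrightarrow> admissible N y w"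
  using assms by (auto simp: sound_nfa_def)

text \<open>A completion of \<open>w @ [a]\<close> at \<open>y\<close>, preceded by
  \<open>a\<close>, is a completion of \<open>w\<close> at \<open>x\<close>.\<close>

lemma admissible_symbol:
  "(x, Some a, y) \<in> ntrans N \<Longrightarrow> admissible N x w \<Longrightarrow> admissible N y (w @ [a])"
  by (force simp: admissible_def dest: strict_path_Cons)

lemma admissible_eps_path:
  "eps_path N x v y \<Longrightarrow> sound_nfa N \<Longrightarrow> admissible N x w \<Longrightarrow> admissible N y (w @ v)"
proof (induction arbitrary: w rule: eps_path.induct)
  case (eps_path_Nil x)
  then show ?case by simp
next
  case (eps_path_Eps x y v z)
  then show ?case by (blast dest: sound_nfaD(3))
next
  case (eps_path_Cons x a y v z)
  then show ?case using admissible_symbol[of x a y N w] by fastforce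
qed

lemma admissible_Final: "admissible N (Final q) w \<Longrightarrow> reach (q, rev w)"
  by (force simp: admissible_def dest: spec[of _ "[]"] intro: strict_path_Nil)

text \<open>Up to epsilon-transitions, a path from \<open>x\<close> to \<open>Final q\<close> reads
  \<open>rev \<sigma>\<close>; admissibility travels along it, and the empty completion at
  \<open>Final q\<close> yields the configuration.\<close>

lemma admissible_pop_sources:
  assumes "sound_nfa N" "x \<in> pop_sources N q \<sigma>" "admissible N x w"
  shows "reach (q, \<sigma> @ rev w)"
proof (cases "\<sigma> = []")
  case True
  then show ?thesis using assms by (auto simp: pop_sources_def dest: admissible_Final)
next
  case False
  then obtain y where y: "(x, Some (last \<sigma>), y) \<in> ntrans N"
    "eps_path N y (rev (butlast \<sigma>)) (Final q)"
    using assms(2) by (auto simp: pop_sources_def)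
  have "admissible N (Final q) ((w @ [last \<sigma>]) @ rev (butlast \<sigma>))"
    using admissible_eps_path[OF y(2) assms(1)] admissible_symbol[OF y(1) assms(3)] by blast
  from admissible_Final[OF this] show ?thesis
    using False by (metis append.assoc append_butlast_last_id rev_append rev_rev_ident rev_singleton_conv)
qed

text \<open>Symbol paths from old states are the same in both automata, so admissibility there is
  unchanged, and no epsilon-transition is new.\<close>

lemma sound_nfa_grafts:
  assumes "sound_nfa N" "grafts N N'" "wf_nfa N'"
  shows "sound_nfa N'"
proof -
  have "strict_path N x u z" if "strict_path N' x u z" "x \<in> nstates N" for x u z
    by (rule strict_path_cong_ntrans[OF that])
      (use assms(2) wf_nfaD(4)[OF sound_nfaD(1)[OF assms(1)]] in \<open>unfold grafts_def, blast\<close>)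
  then have adm: "admissible N x w \<longleftrightarrow> admissible N' x w" if "x \<in> nstates N" for x w
    using that assms(2) by (auto simp: admissible_def grafts_def extends_def dest: strict_path_mono)
  note wf = sound_nfaD(1)[OF assms(1)]
  have "(x, None, y) \<in> ntrans N" if "(x, None, y) \<in> ntrans N'" for x y
    using that assms(2) by (auto simp: grafts_def)
  then show ?thesis
    unfolding sound_nfa_def
    using adm assms(3) sound_nfaD[OF assms(1)] wf_nfaD(2-4)[OF wf] by metis
qed

lemma strict_path_add_eps: "strict_path (add_eps S y N) x u z \<longleftrightarrow> strict_path N x u z"
proof
  assume "strict_path (add_eps S y N) x u z"
  then show "strict_path N x u z"
    by (rule strict_path_cong_ntrans[where A = UNIV]) (auto simp: add_eps_def)
next
  assume "strict_path N x u z"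
  then show "strict_path (add_eps S y N) x u z"
    by (rule strict_path_mono) (auto simp: add_eps_def)
qed

lemma pop_sources_in_nstates:
  "wf_nfa N \<Longrightarrow> Final q \<in> nstates N \<Longrightarrow> pop_sources N q \<sigma> \<subseteq> nstates N"
  by (auto simp: pop_sources_def dest: wf_nfaD)

text \<open>An admissible \<open>w\<close> at a pop source makes
  \<open>(q, \<sigma> @ rev w)\<close> reachable, hence \<open>(r, \<tau> @ rev w)\<close>; as
  \<open>rev \<tau>\<close> is the only completion at \<open>y\<close>, this is all that
  admissibility of \<open>w\<close> at \<open>y\<close> requires. \<open>S\<close> may be a proper
  subset because the pop sources are computed before the path is established.\<close>

lemma sound_nfa_add_eps:
  assumes N: "sound_nfa N" and \<theta>: "(q, \<sigma>, \<tau>, r) \<in> transitions P0"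
    and S: "S \<subseteq> pop_sources N q \<sigma>" and y: "strict_path N y (rev \<tau>) (Final r)"
    and nst: "Final q \<in> nstates N" "y \<in> nstates N"
  shows "sound_nfa (add_eps S y N)"
proof -
  have adm: "admissible (add_eps S y N) = admissible N"
    by (auto simp: admissible_def strict_path_add_eps fun_eq_iff)
  have tr: "ntrans (add_eps S y N) = ntrans N \<union> {(x, None, y) | x. x \<in> S}"
    and st: "nstates (add_eps S y N) = nstates N"
    by (simp_all add: add_eps_def)
  note wf = sound_nfaD(1)[OF N]
  have "S \<subseteq> nstates N" using S pop_sources_in_nstates[OF wf nst(1)] by blast
  then have "wf_nfa (add_eps S y N)"
    using wf nst(2) unfolding wf_nfa_def by (auto simp: tr st)
  moreover have "admissible N y w" if "x \<in> S" "admissible N x w" for x w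
  proof -
    have "reach (q, \<sigma> @ rev w)"
      using admissible_pop_sources[OF N _ that(2)] S that(1) by blast
    then have "reach (r, \<tau> @ rev w)" using \<theta> by (rule reach_move)
    then show ?thesis
      unfolding admissible_def using strict_path_to_Final_unique[OF wf y] by fastforce
  qed
  ultimately show ?thesis
    using sound_nfaD(2,3)[OF N] unfolding sound_nfa_def by (auto simp: adm tr)
qed

text \<open>Serves both kinds of processing: for a new transition, \<open>N'\<close> is the
  automaton after its path is established; for an old one, \<open>N'\<close> is \<open>N\<close>
  itself.\<close>

lemma invariant_add_eps:
  assumes inv: "invariant (N, U)" and \<theta>: "(q, \<sigma>, \<tau>, r) \<in> transitions P0"
    and q: "Final q \<in> nstates N" and S: "pop_sources N q \<sigma> \<noteq> {}"
    and N': "sound_nfa N'" "extends N N'" and y: "strict_path N' y (rev \<tau>) (Final r)"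
    and yst: "y \<in> nstates N'" and new: "\<forall>x \<in> nstates N' - nstates N. \<exists>u. eps_path N' y u x"
  shows "invariant (add_eps (pop_sources N q \<sigma>) y N', U - {(q, \<sigma>, \<tau>, r)})"
proof -
  let ?N = "add_eps (pop_sources N q \<sigma>) y N'"
  have N: "sound_nfa N" "accessible N" using inv by (auto simp: invariant_def)
  have ext: "ntrans N \<subseteq> ntrans ?N" "ntrans N' \<subseteq> ntrans ?N" "ntrans N \<subseteq> ntrans N'"
    using N'(2) by (auto simp: extends_def add_eps_def)
  obtain x where x: "x \<in> pop_sources N q \<sigma>" using S by blast
  then obtain w where w: "eps_path N M0 w x"
    using N pop_sources_in_nstates[OF sound_nfaD(1)[OF N(1)] q] by (blast dest: accessible_def[THEN iffD1])
  have "sound_nfa ?N"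
    using sound_nfa_add_eps[OF N'(1) \<theta> pop_sources_mono[OF ext(3)] y _ yst] q N'(2)
    by (auto simp: extends_def)
  moreover have "accessible ?N"
    unfolding accessible_def
  proof
    fix n assume n: "n \<in> nstates ?N"
    show "\<exists>v. eps_path ?N M0 v n"
    proof (cases "n \<in> nstates N")
      case True
      then obtain v where "eps_path N M0 v n" using N(2) by (auto simp: accessible_def)
      then show ?thesis using ext(1) by (blast intro: eps_path_mono)
    next
      case False
      \<comment> \<open>An added state lies behind \<open>y\<close>, which the new
        epsilon-transition from the accessible state \<open>x\<close> reaches.\<close>
      then obtain u where "eps_path N' y u n" using n new by (auto simp: add_eps_def)
      then have "eps_path ?N y u n" using ext(2) by (rule eps_path_mono)
      moreover have "(x, None, y) \<in> ntrans ?N" using x by (auto simp: add_eps_def)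
      ultimately have "eps_path ?N x u n" by (blast intro: eps_path_Eps)
      then show ?thesis using eps_path_mono[OF w ext(1)] by (blast intro: eps_path_append)
    qed
  qed
  moreover have "reachable_transition P0 (initial_config P0) (q, \<sigma>, \<tau>, r)"
  proof (rule reach_move(2)[OF _ \<theta>])
    \<comment> \<open>The word \<open>w\<close> read from \<open>M0\<close> to \<open>x\<close> is
      admissible at \<open>x\<close> because the empty word is admissible at
      \<open>M0\<close>.\<close>
    show "reach (q, \<sigma> @ rev w)"
      using admissible_pop_sources[OF N(1) x]
        admissible_eps_path[OF w N(1) sound_nfaD(2)[OF N(1)]] by simp
  qed
  moreover have "strict_path ?N y (rev \<tau>) (Final r)" using y by (simp add: strict_path_add_eps)
  moreover have "Final r \<in> nstates ?N"
    using strict_path_end_in_nstates[OF y sound_nfaD(1)[OF N'(1)] yst] by (simp add: add_eps_def)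
  moreover have "reachable_transition P0 (initial_config P0) (q', \<sigma>', \<tau>', r') \<and>
      Final r' \<in> nstates ?N \<and> (\<exists>y. strict_path ?N y (rev \<tau>') (Final r'))"
    if "(q', \<sigma>', \<tau>', r') \<in> transitions P0" "(q', \<sigma>', \<tau>', r') \<notin> U" for q' \<sigma>' \<tau>' r'
    using invariant_processed[OF inv that] N'(2) strict_path_mono[OF _ ext(1)]
    by (auto simp: extends_def add_eps_def)
  moreover have "U \<subseteq> transitions P0" using inv by (simp add: invariant_def)
  ultimately show ?thesis
    unfolding invariant_def by blast
qed

lemma add_state_grafts: "grafts N (add_state n N)"
  by (auto simp: grafts_def extends_def add_state_def)

lemma wf_nfa_add_state: "wf_nfa N \<Longrightarrow> wf_nfa (add_state n N)"
  by (auto simp: wf_nfa_def add_state_def)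

lemma process_new_establish:
  assumes N: "sound_nfa N" and est: "establish (add_state (Final r) N) (rev \<tau>) (Final r) N' y"
  shows "sound_nfa N'" "extends N N'" "strict_path N' y (rev \<tau>) (Final r)" "y \<in> nstates N'"
    "\<forall>x \<in> nstates N' - nstates N. \<exists>u. eps_path N' y u x"
proof -
  let ?N = "add_state (Final r) N"
  have N1: "sound_nfa ?N"
    using sound_nfa_grafts[OF N add_state_grafts wf_nfa_add_state] sound_nfaD(1)[OF N] by blast
  have r: "Final r \<in> nstates ?N" by (simp add: add_state_def)
  have c: "wf_nfa N'" "grafts ?N N'" "strict_path N' y (rev \<tau>) (Final r)"
    "\<forall>x \<in> nstates N' - nstates ?N. \<exists>u. eps_path N' y u x"
    using establish_correct[OF est sound_nfaD(1)[OF N1] r] by blast+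
  show "sound_nfa N'" using sound_nfa_grafts[OF N1 c(2,1)] .
  show "extends N N'"
    using add_state_grafts[of N] c(2) by (auto simp: grafts_def intro: extends_trans)
  show "strict_path N' y (rev \<tau>) (Final r)" by fact
  show "y \<in> nstates N'"
    using strict_path_start_in_nstates[OF c(1,3)] r c(2) by (auto simp: grafts_def extends_def)
  \<comment> \<open>\<open>Final r\<close> itself may be new; it is reached from \<open>y\<close>
    along the established path.\<close>
  show "\<forall>x \<in> nstates N' - nstates N. \<exists>u. eps_path N' y u x"
    using c(3,4) by (auto simp: add_state_def dest: strict_path_imp_eps_path)
qed

lemma process_invariant:
  assumes "process \<theta> s s'" "\<theta> \<in> transitions P0" "invariant s"
  shows "invariant s'"
  using assms
proof (induction rule: process.induct)
  case (process_stop q N \<sigma> \<tau> r U)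
  then show ?case by blast
next
  case (process_new q N \<sigma> \<tau> r U N' y)
  then have "sound_nfa N" by (simp add: invariant_def)
  note est = process_new_establish[OF this process_new.hyps(4)]
  show ?case
    using invariant_add_eps[OF process_new.prems(2,1) process_new.hyps(1,2) est] .
next
  case (process_old q N \<sigma> \<tau> r U y)
  then have N: "sound_nfa N" by (simp add: invariant_def)
  have "Final r \<in> nstates N"
    using process_old.prems process_old.hyps(3) invariant_processed by blast
  then have "y \<in> nstates N"
    using strict_path_start_in_nstates[OF sound_nfaD(1)[OF N] process_old.hyps(4)] by blast
  then show ?case
    using invariant_add_eps[OF process_old.prems(2,1) process_old.hyps(1,2) N extends_refl
        process_old.hyps(4)] process_old.hyps(3) by simp
qed

lemma invariant_initial: "invariant (initial_nfa P0, transitions P0)"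
proof -
  let ?N = "initial_nfa P0"
  have tr: "(x, l, y) \<in> ntrans ?N \<longleftrightarrow> x = M0 \<and> l = Some B0 \<and> y = Final (initial P0)" for x l y
    by (auto simp: initial_nfa_def)
  have "wf_nfa ?N" by (auto simp: wf_nfa_def initial_nfa_def)
  moreover have "u = [B0] \<and> r = initial P0" if "strict_path ?N M0 u (Final r)" for u r
    using that
  proof cases
    case (strict_path_Cons a y w)
    then have "a = B0" "strict_path ?N (Final (initial P0)) w (Final r)" by (auto simp: tr)
    from this(2) show ?thesis
      by cases (use strict_path_Cons \<open>a = B0\<close> in \<open>auto simp: tr\<close>)
  qed
  then have "admissible ?N M0 []"
    using reach_initial by (force simp: admissible_def)
  moreover have "eps_path ?N M0 [] M0" "eps_path ?N M0 [B0] (Final (initial P0))"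
    by (auto simp: tr intro: eps_path.intros)
  then have "accessible ?N" by (auto simp: accessible_def initial_nfa_def)
  ultimately show ?thesis by (auto simp: invariant_def sound_nfa_def tr)
qed

lemma process_list_invariant:
  "process_list \<theta>s s s' \<Longrightarrow> set \<theta>s \<subseteq> transitions P0 \<Longrightarrow> invariant s \<Longrightarrow> invariant s'"
  by (induction rule: process_list.induct) (auto dest: process_invariant)

lemma pass_invariant: "pass P0 s s' \<Longrightarrow> invariant s \<Longrightarrow> invariant s'"
  by (auto simp: pass_def dest: process_list_invariant)

section \<open>Termination\<close>

text \<open>The implication keeps the relation transitive: as the sets \<open>U\<close> only shrink,
  equality at both ends forces equality in between.\<close>

definition progress :: "('q, 'a xsym) pstate \<Rightarrow> ('q, 'a xsym) pstate \<Rightarrow> bool" where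
  "progress = (\<lambda>(N, U) (N', U'). extends N N' \<and> U' \<subseteq> U \<and>
     (U' = U \<longrightarrow> nstates N' = nstates N \<and>
        ntrans N' - ntrans N \<subseteq> nstates N \<times> {None} \<times> nstates N))"

lemma progress_refl: "progress s s"
  by (auto simp: progress_def extends_def)

lemma progress_trans: "progress s s' \<Longrightarrow> progress s' s'' \<Longrightarrow> progress s s''"
  unfolding progress_def extends_def by (cases s; cases s'; cases s'') (simp, blast)

lemma process_progress:
  assumes "process \<theta> s s'" "invariant s" "\<theta> \<in> transitions P0"
  shows "progress s s'"
  using assms
proof (induction rule: process.induct)
  case (process_stop q N \<sigma> \<tau> r U)
  then show ?case by (blast intro: progress_refl)
next
  case (process_new q N \<sigma> \<tau> r U N' y)
  then have "sound_nfa N" by (simp add: invariant_def)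
  from process_new_establish(2)[OF this process_new.hyps(4)] show ?case
    using process_new.hyps(3) by (auto simp: progress_def extends_def add_eps_def)
next
  case (process_old q N \<sigma> \<tau> r U y)
  then have N: "wf_nfa N" by (simp add: invariant_def sound_nfa_def)
  have "Final r \<in> nstates N"
    using process_old.prems process_old.hyps(3) invariant_processed by blast
  then have "y \<in> nstates N"
    using strict_path_start_in_nstates[OF N process_old.hyps(4)] by blast
  then show ?case
    using pop_sources_in_nstates[OF N process_old.hyps(1)]
    by (auto simp: progress_def extends_def add_eps_def)
qed

lemma process_list_progress:
  "process_list \<theta>s s s' \<Longrightarrow> invariant s \<Longrightarrow> set \<theta>s \<subseteq> transitions P0 \<Longrightarrow> progress s s'"
proof (induction rule: process_list.induct)
  case (process_list_Nil s)
  show ?case by (rule progress_refl)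
next
  case (process_list_Cons \<theta> s s' \<theta>s s'')
  then have "progress s s'" "progress s' s''"
    by (auto dest: process_invariant process_progress)
  then show ?case by (rule progress_trans)
qed

lemma pass_progress: "pass P0 s s' \<Longrightarrow> invariant s \<Longrightarrow> progress s s'"
  by (auto simp: pass_def dest: process_list_progress)

definition missing_eps :: "('q, 'a xsym) nfa \<Rightarrow> nat" where
  "missing_eps N = card (nstates N \<times> {None} \<times> nstates N - ntrans N)"

text \<open>The measure is lexicographic. New states can increase \<open>missing_eps\<close>, but
  they appear only when \<open>U\<close> shrinks; with \<open>U\<close> fixed, a change supplies at
  least one of the finitely many missing epsilon-transitions.\<close>

lemma progress_decreases:
  assumes "progress (N, U) (N', U')" "invariant (N, U)" "N' \<noteq> N"
  shows "((N', U'), (N, U)) \<in> measures [\<lambda>s. card (snd s), \<lambda>s. missing_eps (fst s)]"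
proof (cases "U' = U")
  case True
  then have nst: "nstates N' = nstates N" and ext: "ntrans N \<subseteq> ntrans N'"
    and eps: "ntrans N' - ntrans N \<subseteq> nstates N \<times> {None} \<times> nstates N"
    using assms(1) by (auto simp: progress_def extends_def)
  have "ntrans N' \<noteq> ntrans N" using nst assms(3) by auto
  then have "nstates N' \<times> {None} \<times> nstates N' - ntrans N' \<subset> nstates N \<times> {None} \<times> nstates N - ntrans N"
    using nst ext eps by auto
  moreover have "finite (nstates N)"
    using assms(2) by (auto simp: invariant_def sound_nfa_def dest: wf_nfaD)
  ultimately have "missing_eps N' < missing_eps N"
    unfolding missing_eps_def by (intro psubset_card_mono) auto
  then show ?thesis using True by simp
next
  case False
  have "finite U"
    using assms(2) finite_transitions by (auto simp: invariant_def intro: finite_subset)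
  moreover have "U' \<subset> U" using assms(1) False by (auto simp: progress_def)
  ultimately have "card U' < card U" by (rule psubset_card_mono)
  then show ?thesis by simp
qed

section \<open>Existence of a terminating execution\<close>

lemma process_exists:
  assumes "invariant s" "\<theta> \<in> transitions P0"
  shows "\<exists>s'. process \<theta> s s'"
proof -
  obtain N U q \<sigma> \<tau> r where s: "s = (N, U)" "\<theta> = (q, \<sigma>, \<tau>, r)"
    by (cases s; cases \<theta>) auto
  show ?thesis
  proof (cases "Final q \<notin> nstates N \<or> pop_sources N q \<sigma> = {}")
    case True
    then show ?thesis using s by (blast intro: process_stop)
  next
    case app: False
    show ?thesis
    proof (cases "\<theta> \<in> U")
      case True
      have "finite (nstates (add_state (Final r) N))"
        using assms(1) s by (auto simp: invariant_def sound_nfa_def add_state_def dest: wf_nfaD)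
      then obtain N' y where "establish (add_state (Final r) N) (rev \<tau>) (Final r) N' y"
        using establish_exists by blast
      then show ?thesis using app True s by (blast intro: process_new)
    next
      case False
      \<comment> \<open>The invariant guarantees the path that \<open>process_old\<close> asks
        for.\<close>
      then obtain y where "strict_path N y (rev \<tau>) (Final r)"
        using invariant_processed[of N U] assms s by blast
      then show ?thesis using app False s by (blast intro: process_old)
    qed
  qed
qed

lemma process_list_exists:
  "invariant s \<Longrightarrow> set \<theta>s \<subseteq> transitions P0 \<Longrightarrow> \<exists>s'. process_list \<theta>s s s'"
proof (induction \<theta>s arbitrary: s)
  case Nil
  then show ?case by (blast intro: process_list_Nil)
next
  case (Cons \<theta> \<theta>s)
  then obtain s' where s': "process \<theta> s s'" using process_exists[of s \<theta>] by auto
  then have "invariant s'" using process_invariant Cons.prems by auto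
  then obtain s'' where "process_list \<theta>s s' s''"
    using Cons.IH[of s'] Cons.prems(2) by auto
  with s' have "process_list (\<theta> # \<theta>s) s s''" by (rule process_list_Cons)
  then show ?case ..
qed

lemma pass_exists:
  assumes "invariant s"
  shows "\<exists>s'. pass P0 s s'"
proof -
  obtain \<theta>s where \<theta>s: "set \<theta>s = transitions P0" "distinct \<theta>s"
    using finite_distinct_list[OF finite_transitions] by blast
  obtain s' where "process_list \<theta>s s s'"
    using process_list_exists[OF assms, of \<theta>s] \<theta>s(1) by blast
  with \<theta>s show ?thesis unfolding pass_def by blast
qed

lemma iterate_exists: "invariant s \<Longrightarrow> \<exists>s'. iterate P0 s s'"
proof (induction s rule: wf_induct_rule[OF wf_measures[of "[\<lambda>s. card (snd s), \<lambda>s. missing_eps (fst s)]"]])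
  case (1 s)
  obtain N U N' U' where s: "s = (N, U)" and pass: "pass P0 (N, U) (N', U')"
    using pass_exists[OF 1(2)] by (metis surj_pair)
  show ?case
  proof (cases "N' = N")
    case True
    then show ?thesis using s pass by (blast intro: iterate_stop)
  next
    case False
    have "invariant (N', U')" "progress (N, U) (N', U')"
      using pass 1(2) s pass_invariant pass_progress by blast+
    then show ?thesis
      using 1 s False pass progress_decreases by (meson iterate_again)
  qed
qed

section \<open>Saturation and completeness\<close>

definition applicable :: "('q, 'a xsym) nfa \<Rightarrow> ('q, 'a xsym) transition \<Rightarrow> bool" where
  "applicable N = (\<lambda>(q, \<sigma>, \<tau>, r). Final q \<in> nstates N \<and> pop_sources N q \<sigma> \<noteq> {})"

definition saturated :: "('q, 'a xsym) nfa \<Rightarrow> ('q, 'a xsym) transition \<Rightarrow> bool" where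
  "saturated N = (\<lambda>(q, \<sigma>, \<tau>, r). applicable N (q, \<sigma>, \<tau>, r) \<longrightarrow>
     (\<exists>y. strict_path N y (rev \<tau>) (Final r) \<and> (\<forall>x \<in> pop_sources N q \<sigma>. (x, None, y) \<in> ntrans N)))"

lemma add_eps_fixD: "N = add_eps S y N' \<Longrightarrow> \<forall>x \<in> S. (x, None, y) \<in> ntrans N"
  by (auto simp: add_eps_def)

lemma process_unchanged:
  assumes "process \<theta> (N, U) (N, U')" "sound_nfa N"
  shows "saturated N \<theta> \<and> (applicable N \<theta> \<longrightarrow> \<theta> \<notin> U')"
  using assms(1)
proof cases
  case (process_new q \<sigma> \<tau> r N' y)
  \<comment> \<open>Since the result is \<open>N\<close> again, the established path already lies in
    \<open>N\<close>: it consists of symbol transitions, which \<open>add_eps\<close> leaves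
    alone.\<close>
  have "strict_path N y (rev \<tau>) (Final r)"
    using process_new_establish(3)[OF assms(2) process_new(7)] process_new(2)
    by (metis strict_path_add_eps)
  moreover have "\<forall>x \<in> pop_sources N q \<sigma>. (x, None, y) \<in> ntrans N"
    using process_new(2) by (rule add_eps_fixD)
  ultimately show ?thesis using process_new by (auto simp: saturated_def)
next
  case (process_old q \<sigma> \<tau> r y)
  have "\<forall>x \<in> pop_sources N q \<sigma>. (x, None, y) \<in> ntrans N"
    using process_old(2) by (rule add_eps_fixD)
  then show ?thesis using process_old by (auto simp: saturated_def)
qed (auto simp: saturated_def applicable_def)

lemma process_list_unchanged:
  assumes "process_list \<theta>s s s'" "fst s = N" "fst s' = N" "invariant s" "set \<theta>s \<subseteq> transitions P0"
  shows "\<forall>\<theta> \<in> set \<theta>s. saturated N \<theta> \<and> (applicable N \<theta> \<longrightarrow> \<theta> \<notin> snd s')"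
  using assms
proof (induction rule: process_list.induct)
  case (process_list_Nil s)
  then show ?case by simp
next
  case (process_list_Cons \<theta> s s' \<theta>s s'')
  then have inv: "invariant s'" and "progress s s'"
    by (auto dest: process_invariant process_progress)
  moreover have prog: "progress s' s''"
    using process_list_progress[OF process_list_Cons.hyps(2) inv] process_list_Cons.prems by simp
  \<comment> \<open>The automaton only grows, so equality at both ends of the list leaves no room
    for a change in between.\<close>
  ultimately have s': "fst s' = N"
    using process_list_Cons.prems by (auto simp: progress_def intro: extends_antisym)
  have "process \<theta> (N, snd s) (N, snd s')"
    using process_list_Cons s' by (metis prod.collapse)
  moreover have "sound_nfa N"
    using process_list_Cons.prems by (auto simp: invariant_def)
  ultimately have "saturated N \<theta> \<and> (applicable N \<theta> \<longrightarrow> \<theta> \<notin> snd s')"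
    by (rule process_unchanged)
  moreover have "snd s'' \<subseteq> snd s'" using prog by (auto simp: progress_def)
  ultimately show ?case
    using process_list_Cons.IH s' inv process_list_Cons.prems by auto
qed

text \<open>Saturation comes from the last pass alone; earlier passes hand on the invariant and the
  initial transition.\<close>

lemma iterate_saturated:
  assumes "iterate P0 s s'" "invariant s" "extends (initial_nfa P0) (fst s)"
  shows "invariant s' \<and> extends (initial_nfa P0) (fst s') \<and>
     (\<forall>\<theta> \<in> transitions P0. saturated (fst s') \<theta> \<and> (applicable (fst s') \<theta> \<longrightarrow> \<theta> \<notin> snd s'))"
  using assms
proof (induction rule: iterate.induct)
  case (iterate_stop N U U')
  then obtain \<theta>s where \<theta>s: "set \<theta>s = transitions P0" "process_list \<theta>s (N, U) (N, U')"
    by (auto simp: pass_def)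
  then show ?case
    using process_list_unchanged[OF \<theta>s(2)] pass_invariant iterate_stop by auto
next
  case (iterate_again N U N' U' s)
  then show ?case
    using pass_invariant pass_progress by (fastforce simp: progress_def intro: extends_trans)
qed

text \<open>The path that accepts the old stack reads \<open>rev \<rho>\<close> up to a pop source;
  from there saturation offers a detour through \<open>y\<close> reading \<open>rev \<tau>\<close>,
  so the new stack is accepted as well.\<close>

lemma saturated_step:
  assumes sat: "saturated N (q, \<sigma>, \<tau>, r)" and N: "wf_nfa N"
    and path: "eps_path N M0 (rev (\<sigma> @ \<rho>)) (Final q)"
  shows "applicable N (q, \<sigma>, \<tau>, r) \<and> eps_path N M0 (rev (\<tau> @ \<rho>)) (Final r)"
proof -
  have q: "Final q \<in> nstates N"
    using eps_path_end_in_nstates[OF path N] wf_nfaD(2)[OF N] .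
  obtain x where x: "x \<in> pop_sources N q \<sigma>" "eps_path N M0 (rev \<rho>) x"
  proof (cases "\<sigma> = []")
    case True
    then show ?thesis using that path by (simp add: pop_sources_def)
  next
    case False
    \<comment> \<open>The deepest popped symbol \<open>last \<sigma>\<close> is read right after
      \<open>rev \<rho>\<close>, which is where the path is cut.\<close>
    then have "rev (\<sigma> @ \<rho>) = rev \<rho> @ last \<sigma> # rev (butlast \<sigma>)"
      by (metis append_butlast_last_id rev_append rev_eq_Cons_iff rev_rev_ident)
    from eps_path_split[OF path this] that False show ?thesis
      by (auto simp: pop_sources_def)
  qed
  have app: "applicable N (q, \<sigma>, \<tau>, r)" using x(1) q by (auto simp: applicable_def)
  then obtain y where "strict_path N y (rev \<tau>) (Final r)" "(x, None, y) \<in> ntrans N"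
    using sat x(1) by (auto simp: saturated_def)
  then have "eps_path N x (rev \<tau>) (Final r)"
    by (blast intro: eps_path_Eps strict_path_imp_eps_path)
  then show ?thesis using app eps_path_append[OF x(2)] by simp
qed

text \<open>By \<open>saturated_step\<close>, acceptance passes from each configuration to the next;
  the start is arbitrary so that the induction can move along the run.\<close>

lemma run_applicable:
  assumes "run P0 c \<theta>s c'" "wf_nfa N" "\<forall>\<theta> \<in> transitions P0. saturated N \<theta>"
    "eps_path N M0 (rev (snd c)) (Final (fst c))"
  shows "\<forall>\<theta> \<in> set \<theta>s. applicable N \<theta>"
  using assms
proof (induction rule: run.induct)
  case (run_Nil c)
  then show ?case by simp
next
  case (run_Cons c \<theta> c' \<theta>s c'')
  from run_Cons.hyps(1) obtain q \<sigma> \<tau> r \<rho> where m: "c = (q, \<sigma> @ \<rho>)" "c' = (r, \<tau> @ \<rho>)"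
    "\<theta> = (q, \<sigma>, \<tau>, r)" "(q, \<sigma>, \<tau>, r) \<in> transitions P0"
    by cases auto
  have "applicable N \<theta> \<and> eps_path N M0 (rev (\<tau> @ \<rho>)) (Final r)"
    using saturated_step[of N q \<sigma> \<tau> r \<rho>] m run_Cons.prems by simp
  then show ?case using run_Cons.IH run_Cons.prems m by simp
qed

text \<open>As the procedure is a relation, this keeps the description of its results from being
  vacuous.\<close>

theorem forward_returns_exists: "\<exists>N U. forward_returns P0 N U"
  using iterate_exists[OF invariant_initial] by (auto simp: forward_returns_def)

theorem forward_returns_unreachable:
  assumes "forward_returns P0 N U"
  shows "U = {\<theta> \<in> transitions P0. \<not> reachable_transition P0 (initial_config P0) \<theta>}"
proof -
  have inv: "invariant (N, U)" and ext: "extends (initial_nfa P0) N"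
    and sat: "\<forall>\<theta> \<in> transitions P0. saturated N \<theta> \<and> (applicable N \<theta> \<longrightarrow> \<theta> \<notin> U)"
    using iterate_saturated[OF assms[unfolded forward_returns_def] invariant_initial]
    by (auto simp: extends_refl)
  have U: "U \<subseteq> transitions P0" and N: "wf_nfa N"
    using inv by (auto simp: invariant_def sound_nfa_def)
  have "(M0, Some B0, Final (initial P0)) \<in> ntrans N"
    using ext by (auto simp: extends_def initial_nfa_def)
  then have init: "eps_path N M0 (rev (snd (initial_config P0))) (Final (fst (initial_config P0)))"
    by (auto simp: initial_config_def intro: eps_path.intros)
  \<comment> \<open>A transition employed in a run is applicable in the saturated automaton, and
    applicable transitions have left \<open>U\<close>.\<close>
  have "\<not> reachable_transition P0 (initial_config P0) \<theta>" if "\<theta> \<in> U" for \<theta>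
    using run_applicable[OF _ N _ init] sat U that unfolding reachable_transition_def by blast
  moreover have "reachable_transition P0 (initial_config P0) \<theta>" if "\<theta> \<in> transitions P0 - U" for \<theta>
    using invariant_processed[OF inv] that by (cases \<theta>) blast
  ultimately show ?thesis using U by blast
qed

end

section \<open>Application to the extended automaton\<close>

lemma forward_extended_pda:
  assumes "is_pda P"
  shows "forward (extended_pda P)"
proof
  \<comment> \<open>Written as an image of \<open>transitions P\<close>, this set is seen to be
    finite.\<close>
  have "{(Old q, map Sym \<sigma>, map Sym \<tau>, Old r) | q \<sigma> \<tau> r. (q, \<sigma>, \<tau>, r) \<in> transitions P}
      = (\<lambda>(q, \<sigma>, \<tau>, r). (Old q, map Sym \<sigma>, map Sym \<tau>, Old r)) ` transitions P"
    by force
  moreover have "finite (transitions P)" "finite (finals P)" "finite (alphabet P)"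
    using assms by (auto simp: is_pda_def intro: finite_subset)
  ultimately show "finite (transitions (extended_pda P))"
    by (simp add: extended_pda_def finite_image_set)
  show "\<tau> \<in> lists (alphabet (extended_pda P))"
    if "(q, \<sigma>, \<tau>, r) \<in> transitions (extended_pda P)" for q \<sigma> \<tau> r
    using that assms by (fastforce simp: is_pda_def extended_pda_def)
  show "B0 \<in> alphabet (extended_pda P)"
    by (simp add: extended_pda_def)
qed

theorem theorem1:
  fixes P :: "('q, 'a) pda"
  assumes "is_pda P"
  shows "(\<exists>N U1. forward_returns (extended_pda P) N U1) \<and>
         (\<forall>N U1. forward_returns (extended_pda P) N U1 \<longrightarrow>
            U1 = {\<theta> \<in> transitions (extended_pda P).
                    \<not> reachable_transition (extended_pda P) (initial_config (extended_pda P)) \<theta>})"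
  using forward.forward_returns_exists[OF forward_extended_pda[OF assms]]
    forward.forward_returns_unreachable[OF forward_extended_pda[OF assms]]
  by blast

end
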